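(* Let $M_1,\dots,M_d$ be matroids on the same finite ground set $E$ and let $k\ge 1$ be an integer. If $E$ has a $2k$-covering by sets $V_1,\dots,V_d$ with $V_i$ independent in $M_i$ for every $i$, then Alice has a winning strategy in the matroid $k$-coloring game on $M_1,\dots,M_d$. In particular, every loopless matroid $M$ satisfies $\chi_g(M)\le 2\chi(M)$ and $\chi_{f,g}(M)\le 2\chi_f(M)$.
   Context: A collection of (not necessarily distinct) subsets $V_1,\dots,V_d\subseteq E$ is a $k$-covering of $E$ if every $e\in E$ belongs to exactly $k$ members of the collection. The $k$-coloring game on $M_1,\dots,M_d$: the set of colors is $\{1,\dots,d\}$; Alice and Bob alternately make moves, Alice first; a move consists of choosing an element $e\in E$ that currently has fewer than $k$ colors and a color $i$ not yet assigned to $e$, and assigning $i$ to $e$, subject to the rule that for every $i$ the set of elements having color $i$ must always be independent in $M_i$. Alice wins if every element ends up with exactly $k$ colors; Bob wins if the play reaches a position where no admissible move exists while some element has fewer than $k$ colors. For a loopless matroid $M$: $\chi(M)$ is the minimum number of independent sets needed to partition (equivalently $1$-cover) its ground set; $\chi_f(M)$ is the infimum of $b/a$ over integers $a,b$ such that $M$ has an $a$-covering by $b$ independent sets; $\chi_g(M)$ is the minimum number $d$ of colors such that Alice has a winning strategy in the $1$-coloring game on $M_1=\dots=M_d=M$; $\chi_{f,g}(M)$ is the infimum of $b/a$ over integers $a,b$ such that Alice has a winning strategy in the $a$-coloring game on $M_1=\dots=M_b=M$. *)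

theory Defs
  imports Complex_Main
begin

locale matroid =
  fixes E :: "'a set" and indep :: "'a set \<Rightarrow> bool"
  assumes finite_ground: "finite E"
    and indep_subset_ground: "indep I \<Longrightarrow> I \<subseteq> E"
    and indep_empty: "indep {}"
    and indep_mono: "indep J \<Longrightarrow> I \<subseteq> J \<Longrightarrow> indep I"
    and augmentation: "indep I \<Longrightarrow> indep J \<Longrightarrow> card I < card J \<Longrightarrow>
      \<exists>e \<in> J - I. indep (insert e I)"

definition loopless :: "'a set \<Rightarrow> ('a set \<Rightarrow> bool) \<Rightarrow> bool" where
  "loopless E indep \<longleftrightarrow> (\<forall>e \<in> E. indep {e})"

text \<open>A collection of \<open>d\<close> not necessarily distinct sets is a family indexed by \<open>{1..d}\<close>;
  values of the family outside this range are irrelevant.\<close>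

definition covering :: "'a set \<Rightarrow> nat \<Rightarrow> nat \<Rightarrow> (nat \<Rightarrow> 'a set) \<Rightarrow> bool" where
  "covering E k d V \<longleftrightarrow>
    (\<forall>i \<in> {1..d}. V i \<subseteq> E) \<and> (\<forall>e \<in> E. card {i \<in> {1..d}. e \<in> V i} = k)"

definition indep_covering ::
    "'a set \<Rightarrow> nat \<Rightarrow> nat \<Rightarrow> (nat \<Rightarrow> 'a set \<Rightarrow> bool) \<Rightarrow> (nat \<Rightarrow> 'a set) \<Rightarrow> bool" where
  "indep_covering E k d M V \<longleftrightarrow> covering E k d V \<and> (\<forall>i \<in> {1..d}. M i (V i))"


text \<open>A move \<open>(e, i)\<close> assigns color \<open>i\<close> to the element \<open>e\<close>. A position of the game is given by
  the list of all moves made so far, in chronological order. Alice moves first, so she is to move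
  exactly when this list has even length.\<close>

type_synonym 'a move = "'a \<times> nat"

definition colors_of :: "'a move list \<Rightarrow> 'a \<Rightarrow> nat set" where
  "colors_of h e = {i. (e, i) \<in> set h}"

definition color_class :: "'a move list \<Rightarrow> nat \<Rightarrow> 'a set" where
  "color_class h i = {e. (e, i) \<in> set h}"

definition admissible ::
    "'a set \<Rightarrow> nat \<Rightarrow> nat \<Rightarrow> (nat \<Rightarrow> 'a set \<Rightarrow> bool) \<Rightarrow> 'a move list \<Rightarrow> 'a move \<Rightarrow> bool" where
  "admissible E k d M h m \<longleftrightarrow> (case m of (e, i) \<Rightarrow>
    e \<in> E \<and> card (colors_of h e) < k \<and>
    i \<in> {1..d} \<and> i \<notin> colors_of h e \<and>
    M i (insert e (color_class h i)))"

definition fully_colored :: "'a set \<Rightarrow> nat \<Rightarrow> 'a move list \<Rightarrow> bool" where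
  "fully_colored E k h \<longleftrightarrow> (\<forall>e \<in> E. card (colors_of h e) = k)"

text \<open>The (possibly unfinished) plays in which Alice follows the strategy \<open>s\<close> and Bob makes
  arbitrary admissible moves.\<close>

inductive play_following ::
    "'a set \<Rightarrow> nat \<Rightarrow> nat \<Rightarrow> (nat \<Rightarrow> 'a set \<Rightarrow> bool) \<Rightarrow> ('a move list \<Rightarrow> 'a move) \<Rightarrow>
      'a move list \<Rightarrow> bool"
  for E k d M s where
  start: "play_following E k d M s []"
| alice: "play_following E k d M s h \<Longrightarrow> even (length h) \<Longrightarrow> admissible E k d M h (s h) \<Longrightarrow>
    play_following E k d M s (h @ [s h])"
| bob: "play_following E k d M s h \<Longrightarrow> odd (length h) \<Longrightarrow> admissible E k d M h m \<Longrightarrow>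
    play_following E k d M s (h @ [m])"

text \<open>A winning strategy always supplies an admissible move when it is Alice's turn and one exists,
  and every play following it that cannot be continued is a win for Alice. Since \<open>E\<close> is finite and
  each element is colored at most \<open>k\<close> times, there are no infinite plays.\<close>

definition winning_strategy ::
    "'a set \<Rightarrow> nat \<Rightarrow> nat \<Rightarrow> (nat \<Rightarrow> 'a set \<Rightarrow> bool) \<Rightarrow> ('a move list \<Rightarrow> 'a move) \<Rightarrow> bool" where
  "winning_strategy E k d M s \<longleftrightarrow> (\<forall>h. play_following E k d M s h \<longrightarrow>
    (even (length h) \<and> (\<exists>m. admissible E k d M h m) \<longrightarrow> admissible E k d M h (s h)) \<and>
    ((\<nexists>m. admissible E k d M h m) \<longrightarrow> fully_colored E k h))"

definition alice_wins ::
    "'a set \<Rightarrow> nat \<Rightarrow> nat \<Rightarrow> (nat \<Rightarrow> 'a set \<Rightarrow> bool) \<Rightarrow> bool" where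
  "alice_wins E k d M \<longleftrightarrow> (\<exists>s. winning_strategy E k d M s)"


definition chi :: "'a set \<Rightarrow> ('a set \<Rightarrow> bool) \<Rightarrow> nat" where
  "chi E indep = (LEAST d. \<exists>V. indep_covering E 1 d (\<lambda>_. indep) V)"

definition chi_f :: "'a set \<Rightarrow> ('a set \<Rightarrow> bool) \<Rightarrow> real" where
  "chi_f E indep =
    Inf {real b / real a | a b. 1 \<le> a \<and> (\<exists>V. indep_covering E a b (\<lambda>_. indep) V)}"

definition chi_g :: "'a set \<Rightarrow> ('a set \<Rightarrow> bool) \<Rightarrow> nat" where
  "chi_g E indep = (LEAST d. alice_wins E 1 d (\<lambda>_. indep))"

definition chi_fg :: "'a set \<Rightarrow> ('a set \<Rightarrow> bool) \<Rightarrow> real" where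
  "chi_fg E indep = Inf {real b / real a | a b. 1 \<le> a \<and> alice_wins E a b (\<lambda>_. indep)}"

text \<open>For a loopless matroid the minimum in \<^const>\<open>chi\<close> and the infimum in \<^const>\<open>chi_f\<close> range
  over nonempty sets.\<close>

lemma loopless_ex_indep_covering:
  assumes "matroid E indep" and "loopless E indep"
  shows "\<exists>d V. indep_covering E 1 d (\<lambda>_. indep) V"
proof -
  obtain f where f: "bij_betw f {1..card E} E"
    using ex_bij_betw_nat_finite_1[OF matroid.finite_ground[OF assms(1)]] ..
  have "card {i \<in> {1..card E}. e \<in> {f i}} = 1" if "e \<in> E" for e
  proof -
    have "e \<in> f ` {1..card E}"
      using that bij_betw_imp_surj_on[OF f] by simp
    then obtain j where j: "j \<in> {1..card E}" "e = f j"
      by (rule imageE)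
    have "i = j" if "i \<in> {1..card E}" "e \<in> {f i}" for i
      using that j inj_onD[OF bij_betw_imp_inj_on[OF f], of i j] by simp
    then have "{i \<in> {1..card E}. e \<in> {f i}} = {j}"
      using j by blast
    then show ?thesis by simp
  qed
  moreover have "f i \<in> E" if "i \<in> {1..card E}" for i
    using f that by (rule bij_betw_apply)
  ultimately have "indep_covering E 1 (card E) (\<lambda>_. indep) (\<lambda>i. {f i})"
    using assms(2) unfolding indep_covering_def covering_def loopless_def by blast
  then show ?thesis by blast
qed

end

theory Submission
  imports Defs
begin

text \<open>Alice maintains independent sets \<open>V i\<close>, each containing the elements of color \<open>i\<close>, such that an
  element \<open>e\<close> that still needs \<open>r\<close> colors has at least \<open>2 * r\<close> spare colors, i.e. unassigned colors
  \<open>i\<close> with \<open>e \<in> V i\<close>. If Bob gives an element of \<open>E\<close> a color \<open>j\<close>, then by augmentation \<open>V j\<close>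
  can be repaired at the cost of dropping a single element \<open>g\<close>. Alice answers by giving \<open>g\<close> one of
  its spare colors: the loss caused by both moves is two spare colors, while the need of \<open>g\<close>
  decreases by one. If \<open>g\<close> needs no color, then any spare color of any element does.\<close>

section \<open>Exchange in a matroid\<close>

lemma (in matroid) finite_indep: "indep I \<Longrightarrow> finite I"
  using finite_ground finite_subset indep_subset_ground by blast

text \<open>Iterated augmentation, drawing every new element from \<open>J\<close>. The bound
  \<open>W \<subseteq> I \<union> J\<close> is what later limits an exchange to a single lost
  element.\<close>

lemma (in matroid) augment_to_card:
  assumes "indep I" and "indep J" and "card I \<le> card J"
  shows "\<exists>W. I \<subseteq> W \<and> W \<subseteq> I \<union> J \<and> indep W \<and> card W = card J"
  using assms
proof (induction "card J - card I" arbitrary: I)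
  case 0
  then show ?case by (intro exI[of _ I]) auto
next
  case (Suc n)
  have "card I < card J" using Suc.hyps(2) by linarith
  from augmentation[OF Suc.prems(1,2) this]
  obtain e where e: "e \<in> J - I" "indep (insert e I)" by blast
  have "card (insert e I) = Suc (card I)"
    using e finite_indep Suc.prems by auto
  then have "n = card J - card (insert e I)" "card (insert e I) \<le> card J"
    using Suc.hyps(2) by linarith+
  from Suc.hyps(1)[OF this(1) e(2) Suc.prems(2) this(2)]
  obtain W where "insert e I \<subseteq> W" "W \<subseteq> insert e I \<union> J" "indep W" "card W = card J"
    by blast
  then show ?case using e by (intro exI[of _ W]) auto
qed

text \<open>In the game \<open>U\<close> is a color class inside the maintained set
  \<open>V\<close>, and \<open>f\<close> is the element just colored. Growing
  \<open>insert f U\<close> by elements of \<open>V\<close> to the size of \<open>V\<close> leaves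
  \<open>f\<close> as the only possible newcomer, so at most one element \<open>g\<close> is
  lost.\<close>

lemma (in matroid) insert_exchange:
  assumes "indep V" and "U \<subseteq> V" and "indep (insert f U)"
  shows "\<exists>W g. insert f U \<subseteq> W \<and> indep W \<and> V \<subseteq> insert g W"
proof (cases "f \<in> V")
  case True
  then show ?thesis using assms by (intro exI[of _ V] exI[of _ f]) auto
next
  case False
  have fin: "finite V" "finite U"
    using assms finite_indep by (auto intro: finite_subset)
  show ?thesis
  proof (cases "U = V")
    case True
    \<comment> \<open>Here \<open>insert f U\<close> contains \<open>V\<close> and is already
      larger, so nothing is lost and \<open>g\<close> is a dummy.\<close>
    then show ?thesis using assms by (intro exI[of _ "insert f U"] exI[of _ f]) auto
  next
    case ne: False
    then have "card U < card V" using assms fin by (simp add: psubset_card_mono psubsetI)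
    moreover have "card (insert f U) \<le> Suc (card U)" using fin by (simp add: card_insert_if)
    ultimately have "card (insert f U) \<le> card V" by linarith
    from augment_to_card[OF assms(3,1) this]
    obtain W where W: "insert f U \<subseteq> W" "W \<subseteq> insert f U \<union> V" "indep W" "card W = card V"
      by blast
    have finW: "finite W" using W finite_indep by blast
    have "W - V = {f}" using W False assms(2) by auto
    moreover have "card (W - V) = card (V - W)"
      using card_le_sym_Diff[of V W] card_le_sym_Diff[of W V] fin finW W(4) by simp
    ultimately have "card (V - W) = 1" by simp
    then obtain g where "V - W = {g}" by (auto simp: card_1_singleton_iff)
    then have "V \<subseteq> insert g W" by auto
    then show ?thesis using W by blast
  qed
qed

section \<open>Positions and spare colors\<close>

lemma colors_of_append:
  "colors_of (h @ [(e, i)]) x = (if x = e then insert i (colors_of h x) else colors_of h x)"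
  unfolding colors_of_def by auto

lemma color_class_append:
  "color_class (h @ [(e, i)]) j = (if j = i then insert e (color_class h j) else color_class h j)"
  unfolding color_class_def by auto

lemma finite_colors_of [simp]: "finite (colors_of h e)"
proof -
  have "colors_of h e \<subseteq> snd ` set h"
    unfolding colors_of_def by force
  then show ?thesis by (rule finite_subset) simp
qed

text \<open>If \<open>V i\<close> is independent in \<open>M i\<close> and contains the class of
  color \<open>i\<close>, then giving a spare color \<open>i\<close> to \<open>e\<close> keeps that
  class inside \<open>V i\<close>, hence independent.\<close>

definition spare :: "nat \<Rightarrow> (nat \<Rightarrow> 'a set) \<Rightarrow> 'a move list \<Rightarrow> 'a \<Rightarrow> nat set" where
  "spare d V h e = {i \<in> {1..d}. e \<in> V i \<and> i \<notin> colors_of h e}"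

lemma finite_spare [simp]: "finite (spare d V h e)"
  unfolding spare_def by simp

text \<open>The option \<open>g\<close> records the element, if any, that may lack one spare color.\<close>

definition promising ::
    "'a set \<Rightarrow> nat \<Rightarrow> nat \<Rightarrow> (nat \<Rightarrow> 'a set \<Rightarrow> bool) \<Rightarrow> 'a option \<Rightarrow> 'a move list \<Rightarrow> bool" where
  "promising E k d M g h \<longleftrightarrow> (\<forall>e \<in> E. card (colors_of h e) \<le> k) \<and>
    (\<exists>V. (\<forall>i \<in> {1..d}. color_class h i \<subseteq> V i \<and> M i (V i)) \<and>
      (\<forall>e \<in> E. 2 * (k - card (colors_of h e)) \<le>
        card (spare d V h e) + (if g = Some e then 1 else 0)))"

lemma card_colors_of_move:
  assumes "admissible E k d M h (f, j)" and "\<forall>e \<in> E. card (colors_of h e) \<le> k"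
  shows "\<forall>e \<in> E. card (colors_of (h @ [(f, j)]) e) \<le> k"
  using assms by (auto simp: colors_of_append admissible_def)

section \<open>The effect of one move on the invariant\<close>

lemma promising_bob_move:
  assumes matroids: "\<forall>i \<in> {1..d}. matroid E (M i)"
    and prom: "promising E k d M None h" and adm: "admissible E k d M h m"
  shows "\<exists>g. promising E k d M g (h @ [m])"
proof -
  obtain f j where m: "m = (f, j)" by (cases m)
  obtain V where V: "\<forall>i \<in> {1..d}. color_class h i \<subseteq> V i \<and> M i (V i)"
    and sp: "\<forall>e \<in> E. 2 * (k - card (colors_of h e)) \<le> card (spare d V h e)"
    using prom unfolding promising_def by auto
  have j: "j \<in> {1..d}" "j \<notin> colors_of h f" "M j (insert f (color_class h j))"
    using adm unfolding m admissible_def by auto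
  have "matroid E (M j)" "M j (V j)" "color_class h j \<subseteq> V j"
    using matroids V j(1) by auto
  from matroid.insert_exchange[OF this j(3)]
  obtain W g where W: "insert f (color_class h j) \<subseteq> W" "M j W" "V j \<subseteq> insert g W"
    by blast
  let ?V = "V(j := W)" and ?h = "h @ [(f, j)]"
  have "2 * (k - card (colors_of ?h e)) \<le>
      card (spare d ?V ?h e) + (if Some g = Some e then 1 else 0)" if e: "e \<in> E" for e
  proof (cases "e = f \<or> e = g")
    case True
    \<comment> \<open>Only color \<open>j\<close> can be lost, by \<open>f\<close> because it is now
      assigned, by \<open>g\<close> because \<open>g\<close> may have left \<open>V j\<close>. The
      requirement of \<open>f\<close> falls by two in return; for \<open>g\<close> the option makes
      up the missing one.\<close>
    have "spare d V h e \<subseteq> insert j (spare d ?V ?h e)"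
      unfolding spare_def by (auto simp: colors_of_append)
    then have "card (spare d V h e) \<le> card (insert j (spare d ?V ?h e))"
      by (intro card_mono) auto
    also have "\<dots> \<le> Suc (card (spare d ?V ?h e))"
      by (simp add: card_insert_if)
    finally have "card (spare d V h e) \<le> Suc (card (spare d ?V ?h e))" .
    then show ?thesis
      using bspec[OF sp e] True j(2) by (auto simp: colors_of_append)
  next
    case False
    then have "spare d V h e \<subseteq> spare d ?V ?h e"
      using W(3) unfolding spare_def by (auto simp: colors_of_append)
    then have "card (spare d V h e) \<le> card (spare d ?V ?h e)"
      by (intro card_mono) auto
    then show ?thesis
      using bspec[OF sp e] False by (simp add: colors_of_append)
  qed
  moreover have "\<forall>i \<in> {1..d}. color_class ?h i \<subseteq> ?V i \<and> M i (?V i)"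
    using V W by (auto simp: color_class_append)
  moreover have "\<forall>e \<in> E. card (colors_of ?h e) \<le> k"
    using prom by (intro card_colors_of_move[OF adm[unfolded m]]) (simp add: promising_def)
  ultimately have "promising E k d M (Some g) ?h"
    unfolding promising_def by (intro conjI exI[of _ ?V]) simp_all
  then show ?thesis unfolding m by (rule exI[of _ "Some g"])
qed

lemma promising_alice_move:
  assumes matroids: "\<forall>i \<in> {1..d}. matroid E (M i)"
    and prom: "promising E k d M g h" and unfinished: "\<not> fully_colored E k h"
  shows "\<exists>m. admissible E k d M h m \<and> promising E k d M None (h @ [m])"
proof -
  obtain V where V: "\<forall>i \<in> {1..d}. color_class h i \<subseteq> V i \<and> M i (V i)"
    and sp: "\<forall>e \<in> E. 2 * (k - card (colors_of h e)) \<le>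
      card (spare d V h e) + (if g = Some e then 1 else 0)"
    using prom unfolding promising_def by blast
  have le: "card (colors_of h e) \<le> k" if "e \<in> E" for e
    using prom that unfolding promising_def by blast
  obtain e0 where e0: "e0 \<in> E" "card (colors_of h e0) < k"
    using unfinished le unfolding fully_colored_def by (auto simp: order_less_le)
  \<comment> \<open>Alice plays on \<open>g\<close> if it lies in \<open>E\<close> and still needs a
    color, and on any unfinished element otherwise.\<close>
  obtain f where f: "f \<in> E" "card (colors_of h f) < k"
    and f_first: "\<And>e. e \<in> E \<Longrightarrow> g = Some e \<Longrightarrow> e = f \<or> card (colors_of h e) = k"
  proof (cases "\<exists>e \<in> E. g = Some e \<and> card (colors_of h e) < k")
    case True
    then show ?thesis using that by auto
  next
    case False
    then show ?thesis using that[OF e0] le by (auto simp: order_less_le)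
  qed
  \<comment> \<open>The requirement is at least 2 and the allowance at most 1, so a spare color
    remains. This is where the factor 2 enters.\<close>
  have "card (spare d V h f) \<noteq> 0"
    using bspec[OF sp f(1)] f(2) by (auto split: if_splits)
  then obtain j where j: "j \<in> spare d V h f"
    by (metis card.empty ex_in_conv)
  then have jd: "j \<in> {1..d}" "f \<in> V j" "j \<notin> colors_of h f"
    unfolding spare_def by auto
  have "insert f (color_class h j) \<subseteq> V j" "M j (V j)" "matroid E (M j)"
    using matroids jd V by auto
  then have "M j (insert f (color_class h j))"
    using matroid.indep_mono by blast
  then have adm: "admissible E k d M h (f, j)"
    using f jd unfolding admissible_def by auto
  let ?h = "h @ [(f, j)]"
  have "2 * (k - card (colors_of ?h e)) \<le> card (spare d V ?h e)" if e: "e \<in> E" for e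
  proof (cases "e = f")
    case True
    have "spare d V ?h f = spare d V h f - {j}"
      unfolding spare_def by (auto simp: colors_of_append)
    then have "card (spare d V ?h f) = card (spare d V h f) - 1"
      using j by simp
    \<comment> \<open>The requirement falls by two and the supply by one; the gain of one cancels
      the allowance.\<close>
    then show ?thesis
      using bspec[OF sp f(1)] True jd(3) by (auto simp: colors_of_append split: if_splits)
  next
    case False
    then have "spare d V ?h e = spare d V h e"
      unfolding spare_def by (auto simp: colors_of_append)
    \<comment> \<open>If \<open>e\<close> is the recorded element, it is fully colored by the choice
      of \<open>f\<close> and requires nothing.\<close>
    then show ?thesis
      using bspec[OF sp e] f_first[OF e] False by (auto simp: colors_of_append split: if_splits)
  qed
  moreover have "\<forall>i \<in> {1..d}. color_class ?h i \<subseteq> V i \<and> M i (V i)"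
    using V jd by (auto simp: color_class_append)
  moreover have "\<forall>e \<in> E. card (colors_of ?h e) \<le> k"
    using card_colors_of_move[OF adm] le by blast
  ultimately have "promising E k d M None ?h"
    unfolding promising_def by (intro exI[of _ V] conjI) auto
  then show ?thesis using adm by blast
qed

section \<open>The winning strategy\<close>

lemma fully_colored_no_move:
  assumes "fully_colored E k h"
  shows "\<not> admissible E k d M h m"
  using assms unfolding fully_colored_def admissible_def by (cases m) auto

lemma alice_wins_if_covering:
  assumes matroids: "\<forall>i \<in> {1..d}. matroid E (M i)"
    and cov: "indep_covering E (2 * k) d M V"
  shows "alice_wins E k d M"
proof -
  define s where
    "s h = (SOME m. admissible E k d M h m \<and> promising E k d M None (h @ [m]))" for h
  have s: "admissible E k d M h (s h) \<and> promising E k d M None (h @ [s h])"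
    if "promising E k d M g h" "\<not> fully_colored E k h" for g h
    unfolding s_def using promising_alice_move[OF matroids that] by (rule someI_ex)
  have start: "promising E k d M None []"
    using cov unfolding promising_def indep_covering_def covering_def
    by (auto simp: colors_of_def color_class_def spare_def intro!: exI[of _ V])
  \<comment> \<open>Bob moves at odd length and then needs a position without a deficit, as left by
    Alice; his move may create one.\<close>
  have inv: "(\<exists>g. promising E k d M g h) \<and> (odd (length h) \<longrightarrow> promising E k d M None h)"
    if "play_following E k d M s h" for h
    using that
  proof induction
    case start
    show ?case using \<open>promising E k d M None []\<close> by auto
  next
    case (alice h)
    then have "promising E k d M None (h @ [s h])"
      using s fully_colored_no_move by blast
    then show ?case by blast
  next
    case (bob h m)
    then have "\<exists>g. promising E k d M g (h @ [m])"
      using promising_bob_move[OF matroids] by blast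
    then show ?case using bob by simp
  qed
  have "winning_strategy E k d M s"
    unfolding winning_strategy_def
  proof (intro allI impI conjI)
    fix h assume h: "play_following E k d M s h"
    then obtain g where g: "promising E k d M g h" using inv by blast
    show "admissible E k d M h (s h)" if "even (length h) \<and> (\<exists>m. admissible E k d M h m)"
      using s[OF g] that fully_colored_no_move by blast
    \<comment> \<open>An unfinished promising position admits the move \<open>s h\<close> whoever is
      to move, so neither player can get stuck in it.\<close>
    show "fully_colored E k h" if "\<nexists>m. admissible E k d M h m"
      using s[OF g] that by blast
  qed
  then show ?thesis unfolding alice_wins_def by blast
qed

section \<open>Consequences for the chromatic numbers\<close>

lemma indep_covering_double:
  assumes "indep_covering E a b (\<lambda>_. indep) V"
  shows "\<exists>V'. indep_covering E (2 * a) (2 * b) (\<lambda>_. indep) V'"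
proof -
  \<comment> \<open>Indices above \<open>b\<close> repeat the family, so every set occurs
    twice.\<close>
  define V' where "V' i = (if i \<le> b then V i else V (i - b))" for i
  have "card {i \<in> {1..2 * b}. e \<in> V' i} = 2 * a" if "e \<in> E" for e
  proof -
    let ?A = "{i \<in> {1..b}. e \<in> V i}"
    have "i \<in> (\<lambda>i. i + b) ` ?A" if "i \<le> 2 * b" "e \<in> V (i - b)" "\<not> i \<le> b" for i
      using that by (intro image_eqI[of _ _ "i - b"]) auto
    then have "{i \<in> {1..2 * b}. e \<in> V' i} = ?A \<union> (\<lambda>i. i + b) ` ?A"
      unfolding V'_def by (auto split: if_splits)
    moreover have "?A \<inter> (\<lambda>i. i + b) ` ?A = {}" by auto
    moreover have "card ((\<lambda>i. i + b) ` ?A) = card ?A" by (intro card_image) simp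
    moreover have "card ?A = a"
      using assms that unfolding indep_covering_def covering_def by auto
    ultimately show ?thesis by (simp add: card_Un_disjoint)
  qed
  moreover have "V' i \<subseteq> E \<and> indep (V' i)" if "i \<in> {1..2 * b}" for i
  proof -
    have "V j \<subseteq> E \<and> indep (V j)" if "j \<in> {1..b}" for j
      using assms that unfolding indep_covering_def covering_def by blast
    moreover have "i - b \<in> {1..b}" if "\<not> i \<le> b"
      using that \<open>i \<in> {1..2 * b}\<close> by auto
    ultimately show ?thesis using that unfolding V'_def by auto
  qed
  ultimately have "indep_covering E (2 * a) (2 * b) (\<lambda>_. indep) V'"
    unfolding indep_covering_def covering_def by blast
  then show ?thesis by (rule exI[of _ V'])
qed

lemma alice_wins_double:
  assumes "matroid E indep" and "indep_covering E a b (\<lambda>_. indep) V"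
  shows "alice_wins E a (2 * b) (\<lambda>_. indep)"
proof -
  obtain V' where "indep_covering E (2 * a) (2 * b) (\<lambda>_. indep) V'"
    using indep_covering_double[OF assms(2)] ..
  then show ?thesis by (rule alice_wins_if_covering[rotated]) (simp add: assms(1))
qed

lemma chi_g_le:
  assumes "matroid E indep" and "loopless E indep"
  shows "chi_g E indep \<le> 2 * chi E indep"
proof -
  \<comment> \<open>Looplessness ensures that the least number defining \<open>chi\<close> is
    attained.\<close>
  obtain V where "indep_covering E 1 (chi E indep) (\<lambda>_. indep) V"
    using LeastI_ex[OF loopless_ex_indep_covering[OF assms]] unfolding chi_def by blast
  then show ?thesis
    unfolding chi_g_def by (intro Least_le alice_wins_double[OF assms(1)])
qed

lemma chi_fg_le:
  assumes "matroid E indep" and "loopless E indep"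
  shows "chi_fg E indep \<le> 2 * chi_f E indep"
proof -
  let ?S = "{real b / real a | a b. 1 \<le> a \<and> (\<exists>V. indep_covering E a b (\<lambda>_. indep) V)}"
  let ?T = "{real b / real a | a b. 1 \<le> a \<and> alice_wins E a b (\<lambda>_. indep)}"
  \<comment> \<open>The greatest-lower-bound rule for a real \<open>Inf\<close> requires a nonempty
    set. It then suffices to bound each ratio in \<open>?S\<close> below by half of
    \<open>chi_fg\<close>.\<close>
  have "?S \<noteq> {}"
    using loopless_ex_indep_covering[OF assms] by blast
  moreover have "chi_fg E indep / 2 \<le> x" if "x \<in> ?S" for x
  proof -
    from that obtain a b V where ab: "x = real b / real a" "1 \<le> a"
      and V: "indep_covering E a b (\<lambda>_. indep) V"
      by (elim CollectE exE conjE) (rule that)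
    have "real (2 * b) / real a \<in> ?T"
      using alice_wins_double[OF assms(1) V] ab(2) by blast
    moreover have "bdd_below ?T" by (rule bdd_belowI[of _ 0]) auto
    ultimately have "chi_fg E indep \<le> real (2 * b) / real a"
      unfolding chi_fg_def by (rule cInf_lower)
    then show ?thesis using ab(1) by (simp add: mult.commute)
  qed
  ultimately have "chi_fg E indep / 2 \<le> chi_f E indep"
    unfolding chi_f_def by (rule cInf_greatest)
  then show ?thesis by simp
qed

theorem theorem1:
  fixes E :: "'a set"
  assumes "finite E"
  shows "(\<forall>(d::nat) (k::nat) (M :: nat \<Rightarrow> 'a set \<Rightarrow> bool) (V :: nat \<Rightarrow> 'a set).
            (\<forall>i \<in> {1..d}. matroid E (M i)) \<longrightarrow> 1 \<le> k \<longrightarrow>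
            indep_covering E (2 * k) d M V \<longrightarrow> alice_wins E k d M)
       \<and> (\<forall>M :: 'a set \<Rightarrow> bool. matroid E M \<longrightarrow> loopless E M \<longrightarrow>
            chi_g E M \<le> 2 * chi E M \<and> chi_fg E M \<le> 2 * chi_f E M)"
  by (intro conjI allI impI alice_wins_if_covering chi_g_le chi_fg_le)

end
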